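(* Let $(A,\cdot,\alpha)$ be a Hom-pre-Malcev algebra and let $(V,\ell,r,\beta)$ be a representation of $(A,\cdot,\alpha)$ with $\beta$ invertible. Then the quadruple $(V^*,\ \ell^\star-r^\star,\ -r^\star,\ (\beta^{-1})^* )$ is a representation of $(A,\cdot,\alpha)$.
   Context: All vector spaces are over a field $\mathbb{K}$ of characteristic $0$. A Hom-pre-Malcev algebra is a triple $(A,\cdot,\alpha)$ consisting of a vector space $A$, a bilinear product $\cdot:A\times A\to A$ and a linear map $\alpha:A\to A$ such that for all $x,y,z,t\in A$, with $[x,y]=x\cdot y-y\cdot x$, $$\alpha([y,z])\cdot\alpha(x\cdot t)+[[x,y],\alpha(z)]\cdot\alpha^2(t)+\alpha^2(y)\cdot([x,z]\cdot\alpha(t))-\alpha^2(x)\cdot(\alpha(y)\cdot(z\cdot t))+\alpha^2(z)\cdot(\alpha(x)\cdot(y\cdot t))=0.$$ A representation of $(A,\cdot,\alpha)$ is a quadruple $(V,\ell,r,\beta)$, where $V$ is a vector space, $\beta\in \mathrm{End}(V)$ and $\ell,r:A\to \mathrm{End}(V)$ are linear maps such that, with $\rho=\ell-r$, for all $x,y,z\in A$: $$\ell(\alpha(x))\beta=\beta\ell(x),\qquad r(\alpha(x))\beta=\beta r(x),$$ $$\ell([[x,y],\alpha(z)])\beta^2=\ell(\alpha^2(x))\ell(\alpha(y))\ell(z)-\ell(\alpha^2(z))\ell(\alpha(x))\ell(y)+\ell(\alpha^2(y))\ell([z,x])\beta-\ell(\alpha([y,z]))\ell(\alpha(x))\beta,$$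 $$r(\alpha^2(x))\rho(\alpha(y))\rho(z)-r(\alpha(z)\cdot(y\cdot x))\beta^2+\ell(\alpha^2(y))r(z\cdot x)\beta+\ell(\alpha([z,y]))r(\alpha(x))\beta-\ell(\alpha^2(z))r(\alpha(x))\rho(y)=0,$$ $$\ell(\alpha^2(y))\ell(\alpha(z))r(x)-r(\alpha^2(x))\rho(\alpha(y))\rho(z)-\ell(\alpha^2(z))r(y\cdot x)\beta-r(\alpha(z\cdot x))\rho(\alpha(y))\beta+r([z,y]\cdot\alpha(x))\beta^2=0,$$ $$r(\alpha(y)\cdot(z\cdot x))\beta^2+r(\alpha^2(x))\rho([y,z])\beta-\ell(\alpha^2(y))\ell(\alpha(z))r(x)+r(\alpha(y\cdot x))\rho(\alpha(z))\beta+\ell(\alpha^2(z))r(\alpha(x))\rho(y)=0.$$ Let $V^*$ be the dual vector space of $V$, $\langle\cdot,\cdot\rangle$ the canonical pairing. For $f:A\to \mathrm{End}(V)$ linear ($f=\ell$ or $r$) define $f^*:A\to \mathrm{End}(V^* )$ by $\langle f^*(x)(\xi),a\rangle=-\langle\xi,f(x)(a)\rangle$ for $x\in A,\ \xi\in V^*,\ a\in V$. For an endomorphism $g$ of $V$, $g^*$ denotes its transpose, $\langle g^*(\xi),a\rangle=\langle\xi,g(a)\rangle$. When $\beta$ is invertible define $f^\star:A\to \mathrm{End}(V^* )$ by $f^\star(x)(\xi)=f^*(\alpha(x))\big((\beta^{-2})^*(\xi)\big)$. *)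

theory Defs
  imports Complex_Main "HOL-Library.Function_Algebras"
begin

definition commutator :: "('a \<Rightarrow> 'a \<Rightarrow> 'a::ab_group_add) \<Rightarrow> 'a \<Rightarrow> 'a \<Rightarrow> 'a" where
  "commutator mul x y = mul x y - mul y x"

locale hom_pre_malcev = vector_space scale
  for scale :: "'k::field_char_0 \<Rightarrow> 'a::ab_group_add \<Rightarrow> 'a" +
  fixes mul :: "'a \<Rightarrow> 'a \<Rightarrow> 'a" (infixl "\<cdot>" 70)
    and \<alpha> :: "'a \<Rightarrow> 'a"
  assumes mul_linear_left: "Vector_Spaces.linear scale scale (\<lambda>x. x \<cdot> y)"
    and mul_linear_right: "Vector_Spaces.linear scale scale (\<lambda>y. x \<cdot> y)"
    and alpha_linear: "Vector_Spaces.linear scale scale \<alpha>"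
    and hom_pre_malcev_identity:
      "\<alpha> (commutator mul y z) \<cdot> \<alpha> (x \<cdot> t)
       + commutator mul (commutator mul x y) (\<alpha> z) \<cdot> \<alpha> (\<alpha> t)
       + \<alpha> (\<alpha> y) \<cdot> (commutator mul x z \<cdot> \<alpha> t)
       - \<alpha> (\<alpha> x) \<cdot> (\<alpha> y \<cdot> (z \<cdot> t))
       + \<alpha> (\<alpha> z) \<cdot> (\<alpha> x \<cdot> (y \<cdot> t)) = 0"
begin

abbreviation bracket :: "'a \<Rightarrow> 'a \<Rightarrow> 'a" ("\<lbrakk>_, _\<rbrakk>") where
  "\<lbrakk>x, y\<rbrakk> \<equiv> commutator mul x y"

end

text \<open>The underlying space of a representation is a subspace \<open>W\<close> of an ambient
  vector space given by a type. This is needed because the algebraic dual of a space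
  with scalar multiplication \<open>scale\<close> depends on \<open>scale\<close>, hence is not a type of its own;
  it is the subspace of linear functionals inside the space of all functions.
  Only the values of the structure maps on \<open>W\<close> matter.\<close>

definition endomorphism_on ::
  "('k \<Rightarrow> 'v \<Rightarrow> 'v) \<Rightarrow> 'v set \<Rightarrow> ('v \<Rightarrow> 'v::ab_group_add) \<Rightarrow> bool" where
  "endomorphism_on scale W f \<longleftrightarrow>
     (\<forall>v\<in>W. f v \<in> W) \<and>
     (\<forall>u\<in>W. \<forall>v\<in>W. f (u + v) = f u + f v) \<and>
     (\<forall>c. \<forall>v\<in>W. f (scale c v) = scale c (f v))"

lemma endomorphism_on_UNIV:
  assumes "vector_space scale"
  shows "endomorphism_on scale UNIV f \<longleftrightarrow> Vector_Spaces.linear scale scale f"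
proof -
  interpret vector_space scale by (rule assms)
  show ?thesis
    unfolding endomorphism_on_def Vector_Spaces.linear_iff
    using assms by blast
qed

text \<open>Differences of functions are pointwise, so \<open>l - r\<close> is the map written \<open>\<rho>\<close> in the
  literature.\<close>

locale hom_pre_malcev_representation =
  hom_pre_malcev scale mul \<alpha> + V: vector_space scaleV
  for scale :: "'k::field_char_0 \<Rightarrow> 'a::ab_group_add \<Rightarrow> 'a"
    and mul :: "'a \<Rightarrow> 'a \<Rightarrow> 'a" (infixl "\<cdot>" 70)
    and \<alpha> :: "'a \<Rightarrow> 'a"
    and scaleV :: "'k \<Rightarrow> 'v::ab_group_add \<Rightarrow> 'v" +
  fixes W :: "'v set"
    and l r :: "'a \<Rightarrow> 'v \<Rightarrow> 'v"
    and \<beta> :: "'v \<Rightarrow> 'v"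
  assumes subspace_W: "V.subspace W"
    and beta_endo: "endomorphism_on scaleV W \<beta>"
    and l_endo: "endomorphism_on scaleV W (l x)"
    and r_endo: "endomorphism_on scaleV W (r x)"
    and l_add: "v \<in> W \<Longrightarrow> l (x + y) v = l x v + l y v"
    and l_scale: "v \<in> W \<Longrightarrow> l (scale c x) v = scaleV c (l x v)"
    and r_add: "v \<in> W \<Longrightarrow> r (x + y) v = r x v + r y v"
    and r_scale: "v \<in> W \<Longrightarrow> r (scale c x) v = scaleV c (r x v)"
    and l_beta: "v \<in> W \<Longrightarrow> l (\<alpha> x) (\<beta> v) = \<beta> (l x v)"
    and r_beta: "v \<in> W \<Longrightarrow> r (\<alpha> x) (\<beta> v) = \<beta> (r x v)"
    and rep1: "v \<in> W \<Longrightarrow>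
      l \<lbrakk>\<lbrakk>x, y\<rbrakk>, \<alpha> z\<rbrakk> (\<beta> (\<beta> v))
      = l (\<alpha> (\<alpha> x)) (l (\<alpha> y) (l z v))
      - l (\<alpha> (\<alpha> z)) (l (\<alpha> x) (l y v))
      + l (\<alpha> (\<alpha> y)) (l \<lbrakk>z, x\<rbrakk> (\<beta> v))
      - l (\<alpha> \<lbrakk>y, z\<rbrakk>) (l (\<alpha> x) (\<beta> v))"
    and rep2: "v \<in> W \<Longrightarrow>
      r (\<alpha> (\<alpha> x)) ((l - r) (\<alpha> y) ((l - r) z v))
      - r (\<alpha> z \<cdot> (y \<cdot> x)) (\<beta> (\<beta> v))
      + l (\<alpha> (\<alpha> y)) (r (z \<cdot> x) (\<beta> v))
      + l (\<alpha> \<lbrakk>z, y\<rbrakk>) (r (\<alpha> x) (\<beta> v))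
      - l (\<alpha> (\<alpha> z)) (r (\<alpha> x) ((l - r) y v)) = 0"
    and rep3: "v \<in> W \<Longrightarrow>
      l (\<alpha> (\<alpha> y)) (l (\<alpha> z) (r x v))
      - r (\<alpha> (\<alpha> x)) ((l - r) (\<alpha> y) ((l - r) z v))
      - l (\<alpha> (\<alpha> z)) (r (y \<cdot> x) (\<beta> v))
      - r (\<alpha> (z \<cdot> x)) ((l - r) (\<alpha> y) (\<beta> v))
      + r (\<lbrakk>z, y\<rbrakk> \<cdot> \<alpha> x) (\<beta> (\<beta> v)) = 0"
    and rep4: "v \<in> W \<Longrightarrow>
      r (\<alpha> y \<cdot> (z \<cdot> x)) (\<beta> (\<beta> v))
      + r (\<alpha> (\<alpha> x)) ((l - r) \<lbrakk>y, z\<rbrakk> (\<beta> v))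
      - l (\<alpha> (\<alpha> y)) (l (\<alpha> z) (r x v))
      + r (\<alpha> (y \<cdot> x)) ((l - r) (\<alpha> z) (\<beta> v))
      + l (\<alpha> (\<alpha> z)) (r (\<alpha> x) ((l - r) y v)) = 0"

definition dual_space :: "('k::field \<Rightarrow> 'v::ab_group_add \<Rightarrow> 'v) \<Rightarrow> ('v \<Rightarrow> 'k) set" where
  "dual_space scale = {\<xi>. Vector_Spaces.linear scale (*) \<xi>}"

definition dual_scale :: "'k::field \<Rightarrow> ('v \<Rightarrow> 'k) \<Rightarrow> ('v \<Rightarrow> 'k)" where
  "dual_scale c \<xi> = (\<lambda>a. c * \<xi> a)"

lemma vector_space_dual_scale: "vector_space dual_scale"
  by unfold_locales (auto simp: dual_scale_def fun_eq_iff algebra_simps)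

lemma subspace_dual_space:
  assumes "vector_space scale"
  shows "module.subspace dual_scale (dual_space scale)"
proof -
  interpret D: vector_space dual_scale by (rule vector_space_dual_scale)
  have K: "vector_space ((*) :: 'a \<Rightarrow> 'a \<Rightarrow> 'a)"
    by unfold_locales (simp_all add: algebra_simps)
  show ?thesis
    unfolding D.subspace_def dual_space_def dual_scale_def Vector_Spaces.linear_iff
    by (simp add: assms K algebra_simps)
qed

definition transpose_map :: "('v \<Rightarrow> 'v) \<Rightarrow> ('v \<Rightarrow> 'k) \<Rightarrow> ('v \<Rightarrow> 'k)" where
  "transpose_map g \<xi> = (\<lambda>a. \<xi> (g a))"

definition dual_action ::
  "('a \<Rightarrow> 'v \<Rightarrow> 'v) \<Rightarrow> 'a \<Rightarrow> ('v \<Rightarrow> 'k::ab_group_add) \<Rightarrow> ('v \<Rightarrow> 'k)" where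
  "dual_action f x \<xi> = (\<lambda>a. - \<xi> (f x a))"

definition star_action ::
  "('a \<Rightarrow> 'a) \<Rightarrow> ('v \<Rightarrow> 'v) \<Rightarrow> ('a \<Rightarrow> 'v \<Rightarrow> 'v) \<Rightarrow>
   'a \<Rightarrow> ('v \<Rightarrow> 'k::ab_group_add) \<Rightarrow> ('v \<Rightarrow> 'k)" where
  "star_action \<alpha> \<beta> f x \<xi> = dual_action f (\<alpha> x) (transpose_map (inv \<beta> ^^ 2) \<xi>)"

end

theory Submission
  imports Defs
begin

text \<open>Write \<open>\<rho> = \<ell> - r\<close> and \<open>b = \<beta>\<^sup>-\<^sup>1\<close>. Because \<open>f (\<alpha> x) \<beta> = \<beta> f x\<close> for \<open>f = \<ell>, r, \<rho>\<close>, the operator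
  \<open>f\<^sup>\<star> x\<close> is minus the transpose of the symmetric expression \<open>b (f x) b\<close> (\<open>star_conjugate\<close>).
  The dual quadruple therefore consists of \<open>L = \<rho>\<^sup>\<star>\<close>, \<open>R = - r\<^sup>\<star>\<close> with \<open>L - R = \<ell>\<^sup>\<star>\<close>.

  Every monomial in the four representation identities has twist degree two: it is
  \<open>f (\<alpha>\<^sup>2 x) g (\<alpha> y) h z\<close>, or one of \<open>f (\<alpha>\<^sup>2 x) g w \<beta>\<close> and \<open>g (\<alpha> w) f (\<alpha> x) \<beta>\<close>, or \<open>f t \<beta>\<^sup>2\<close>.
  Transposition reverses the order of composition, and moving powers of \<open>b\<close> past the operators
  turns the dual monomial into \<open>b\<^sup>3 M b\<^sup>3\<close>, where \<open>M\<close> is again such a monomial: the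
  three-fold products are reversed, the second and third kinds are exchanged, and the
  fourth is preserved (\<open>star_transpose\<close>).

  Replacing \<open>(L, R, L - R)\<close> by \<open>(\<rho>\<^sup>\<star>, - r\<^sup>\<star>, \<ell>\<^sup>\<star>)\<close> and transposing in this way exchanges, up to an overall
  sign and after interchanging \<open>y\<close> and \<open>z\<close>, the second and the fourth identity, and
  maps the third identity to itself. The first identity becomes the same identity with \<open>\<rho>\<close> in
  place of \<open>\<ell>\<close>, and \<open>x\<close>, \<open>y\<close> interchanged. It holds because \<open>\<rho>\<close> is a representation of the commutator
  algebra, which is a signed sum of one instance of each of the four
  identities (\<open>rho_malcev_identity\<close>).\<close>

section \<open>The difference of the left and right actions\<close>

locale invertible_representation =
  hom_pre_malcev_representation scale mul \<alpha> scaleV UNIV l r \<beta>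
  for scale :: "'k::field_char_0 \<Rightarrow> 'a::ab_group_add \<Rightarrow> 'a"
    and mul :: "'a \<Rightarrow> 'a \<Rightarrow> 'a" (infixl "\<cdot>" 70)
    and \<alpha> :: "'a \<Rightarrow> 'a"
    and scaleV :: "'k \<Rightarrow> 'v::ab_group_add \<Rightarrow> 'v"
    and l r :: "'a \<Rightarrow> 'v \<Rightarrow> 'v"
    and \<beta> :: "'v \<Rightarrow> 'v" +
  assumes bij_beta: "bij \<beta>"
begin

sublocale alpha: Vector_Spaces.linear scale scale \<alpha>
  by (rule alpha_linear)

sublocale mul_left: Vector_Spaces.linear scale scale "\<lambda>x. x \<cdot> y" for y
  by (rule mul_linear_left)

sublocale mul_right: Vector_Spaces.linear scale scale "\<lambda>y. x \<cdot> y" for x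
  by (rule mul_linear_right)

sublocale beta: Vector_Spaces.linear scaleV scaleV \<beta>
  using beta_endo V.vector_space_axioms by (simp add: endomorphism_on_UNIV)

sublocale l: Vector_Spaces.linear scaleV scaleV "l x" for x
  using l_endo V.vector_space_axioms by (simp add: endomorphism_on_UNIV)

sublocale r: Vector_Spaces.linear scaleV scaleV "r x" for x
  using r_endo V.vector_space_axioms by (simp add: endomorphism_on_UNIV)

sublocale l_arg: Vector_Spaces.linear scale scaleV "\<lambda>x. l x v" for v
  by unfold_locales (simp_all add: l_add l_scale)

sublocale r_arg: Vector_Spaces.linear scale scaleV "\<lambda>x. r x v" for v
  by unfold_locales (simp_all add: r_add r_scale)

lemmas structure_maps_additive =
  alpha.diff mul_left.diff mul_right.diff l.diff r.diff l_arg.diff r_arg.diff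
  alpha.add mul_left.add mul_right.add l.add r.add l_arg.add r_arg.add

abbreviation \<rho> :: "'a \<Rightarrow> 'v \<Rightarrow> 'v" where
  "\<rho> \<equiv> l - r"

text \<open>This is the defining identity of a representation of the commutator Hom-Malcev algebra.
  The first axiom supplies the monomials in \<open>\<ell>\<close> alone. In each of the other three axioms one
  variable stands under \<open>r\<close> in every monomial; taking it to be \<open>x\<close>, \<open>z\<close> and \<open>y\<close> in turn, their
  negatives supply the monomials that contain \<open>r\<close>.\<close>

lemma rho_malcev_identity:
  "\<rho> \<lbrakk>\<lbrakk>x, y\<rbrakk>, \<alpha> z\<rbrakk> (\<beta> (\<beta> v))
   = \<rho> (\<alpha> (\<alpha> x)) (\<rho> (\<alpha> y) (\<rho> z v))
   - \<rho> (\<alpha> (\<alpha> z)) (\<rho> (\<alpha> x) (\<rho> y v))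
   + \<rho> (\<alpha> (\<alpha> y)) (\<rho> \<lbrakk>z, x\<rbrakk> (\<beta> v))
   - \<rho> (\<alpha> \<lbrakk>y, z\<rbrakk>) (\<rho> (\<alpha> x) (\<beta> v))"
proof -
  let ?E1 = "l (\<alpha> (\<alpha> x)) (l (\<alpha> y) (l z v)) - l (\<alpha> (\<alpha> z)) (l (\<alpha> x) (l y v))
      + l (\<alpha> (\<alpha> y)) (l \<lbrakk>z, x\<rbrakk> (\<beta> v)) - l (\<alpha> \<lbrakk>y, z\<rbrakk>) (l (\<alpha> x) (\<beta> v))
      - l \<lbrakk>\<lbrakk>x, y\<rbrakk>, \<alpha> z\<rbrakk> (\<beta> (\<beta> v))"
  let ?E2 = "r (\<alpha> (\<alpha> x)) (\<rho> (\<alpha> y) (\<rho> z v)) - r (\<alpha> z \<cdot> (y \<cdot> x)) (\<beta> (\<beta> v))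
      + l (\<alpha> (\<alpha> y)) (r (z \<cdot> x) (\<beta> v)) + l (\<alpha> \<lbrakk>z, y\<rbrakk>) (r (\<alpha> x) (\<beta> v))
      - l (\<alpha> (\<alpha> z)) (r (\<alpha> x) (\<rho> y v))"
  let ?E3 = "l (\<alpha> (\<alpha> x)) (l (\<alpha> y) (r z v)) - r (\<alpha> (\<alpha> z)) (\<rho> (\<alpha> x) (\<rho> y v))
      - l (\<alpha> (\<alpha> y)) (r (x \<cdot> z) (\<beta> v)) - r (\<alpha> (y \<cdot> z)) (\<rho> (\<alpha> x) (\<beta> v))
      + r (\<lbrakk>y, x\<rbrakk> \<cdot> \<alpha> z) (\<beta> (\<beta> v))"
  let ?E4 = "r (\<alpha> z \<cdot> (x \<cdot> y)) (\<beta> (\<beta> v)) + r (\<alpha> (\<alpha> y)) (\<rho> \<lbrakk>z, x\<rbrakk> (\<beta> v))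
      - l (\<alpha> (\<alpha> z)) (l (\<alpha> x) (r y v)) + r (\<alpha> (z \<cdot> y)) (\<rho> (\<alpha> x) (\<beta> v))
      + l (\<alpha> (\<alpha> x)) (r (\<alpha> y) (\<rho> z v))"
  have E1: "?E1 = 0"
    using rep1[where x = x and y = y and z = z and v = v] by simp
  have E2: "?E2 = 0"
    using rep2[where x = x and y = y and z = z and v = v] by simp
  have E3: "?E3 = 0"
    using rep3[where x = z and y = x and z = y and v = v] by simp
  have E4: "?E4 = 0"
    using rep4[where x = y and y = z and z = x and v = v] by simp
  have "\<rho> (\<alpha> (\<alpha> x)) (\<rho> (\<alpha> y) (\<rho> z v))
      - \<rho> (\<alpha> (\<alpha> z)) (\<rho> (\<alpha> x) (\<rho> y v))
      + \<rho> (\<alpha> (\<alpha> y)) (\<rho> \<lbrakk>z, x\<rbrakk> (\<beta> v))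
      - \<rho> (\<alpha> \<lbrakk>y, z\<rbrakk>) (\<rho> (\<alpha> x) (\<beta> v))
      - \<rho> \<lbrakk>\<lbrakk>x, y\<rbrakk>, \<alpha> z\<rbrakk> (\<beta> (\<beta> v)) = ?E1 - ?E2 - ?E3 - ?E4"
    by (simp add: commutator_def structure_maps_additive algebra_simps)
  then show ?thesis
    using E1 E2 E3 E4 by (simp only: diff_self) (simp add: algebra_simps)
qed

text \<open>Interchanging \<open>x\<close> and \<open>y\<close> changes the sign of the left-hand side; what results on the
  right is exactly the identity that the transpose has to satisfy.\<close>

lemma rho_malcev_identity_reversed:
  "\<rho> \<lbrakk>\<lbrakk>x, y\<rbrakk>, \<alpha> z\<rbrakk> (\<beta> (\<beta> v))
   = \<rho> (\<alpha> (\<alpha> z)) (\<rho> (\<alpha> y) (\<rho> x v))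
   - \<rho> (\<alpha> (\<alpha> y)) (\<rho> (\<alpha> x) (\<rho> z v))
   + \<rho> (\<alpha> (\<alpha> x)) (\<rho> \<lbrakk>y, z\<rbrakk> (\<beta> v))
   - \<rho> (\<alpha> \<lbrakk>z, x\<rbrakk>) (\<rho> (\<alpha> y) (\<beta> v))"
  using rho_malcev_identity[of y x z v]
  by (simp add: commutator_def structure_maps_additive algebra_simps)

section \<open>Transposing the operators\<close>

definition intertwines :: "('a \<Rightarrow> 'v \<Rightarrow> 'v) \<Rightarrow> bool" where
  "intertwines f \<longleftrightarrow> (\<forall>x v. f (\<alpha> x) (\<beta> v) = \<beta> (f x v))"

lemma intertwinesD: "intertwines f \<Longrightarrow> f (\<alpha> x) (\<beta> v) = \<beta> (f x v)"
  by (simp add: intertwines_def)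

lemma intertwines_l: "intertwines l"
  and intertwines_r: "intertwines r"
  and intertwines_rho: "intertwines \<rho>"
  by (simp_all add: intertwines_def l_beta r_beta beta.diff)

lemma inv_beta [simp]: "inv \<beta> (\<beta> v) = v" "\<beta> (inv \<beta> v) = v"
  using bij_beta by (simp_all add: bij_is_inj bij_is_surj surj_f_inv_f)

sublocale inv_beta: Vector_Spaces.linear scaleV scaleV "inv \<beta>"
proof unfold_locales
  fix u v c
  show "inv \<beta> (u + v) = inv \<beta> u + inv \<beta> v"
    by (metis inv_beta beta.add)
  show "inv \<beta> (scaleV c v) = scaleV c (inv \<beta> v)"
    by (metis inv_beta beta.scale)
qed

abbreviation star :: "('a \<Rightarrow> 'v \<Rightarrow> 'v) \<Rightarrow> 'a \<Rightarrow> ('v \<Rightarrow> 'k) \<Rightarrow> 'v \<Rightarrow> 'k" where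
  "star \<equiv> star_action \<alpha> \<beta>"

text \<open>One of the two factors \<open>\<beta>\<^sup>-\<^sup>1\<close> in the definition moves across \<open>f (\<alpha> x)\<close> and removes the
  twist by \<open>\<alpha>\<close>, leaving an expression in which \<open>\<alpha>\<close> no longer occurs.\<close>

lemma star_conjugate:
  assumes "intertwines f"
  shows "star f x \<xi> v = - \<xi> (inv \<beta> (f x (inv \<beta> v)))"
proof -
  have "f (\<alpha> x) v = \<beta> (f x (inv \<beta> v))"
    using assms by (metis intertwines_def inv_beta(2))
  then show ?thesis
    by (simp add: star_action_def dual_action_def transpose_map_def numeral_2_eq_2)
qed

lemma inv_beta_intertwines:
  assumes "intertwines f"
  shows "inv \<beta> (f (\<alpha> x) v) = f x (inv \<beta> v)"
  using assms by (metis intertwines_def inv_beta)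

text \<open>Three factors \<open>\<beta>\<^sup>-\<^sup>1\<close> are what remains on the left of each monomial below; the three
  on the right are absorbed by evaluating at \<open>\<beta>\<^sup>3 u\<close>.\<close>

abbreviation twist :: "('v \<Rightarrow> 'k) \<Rightarrow> 'v \<Rightarrow> 'k" where
  "twist \<xi> v \<equiv> \<xi> (inv \<beta> (inv \<beta> (inv \<beta> v)))"

abbreviation \<beta>' :: "('v \<Rightarrow> 'k) \<Rightarrow> 'v \<Rightarrow> 'k" where
  "\<beta>' \<equiv> transpose_map (inv \<beta>)"

text \<open>The next four lemmas are the transposition rules for the four kinds of monomials. The signs
  are the parity of the number of operators \<open>f\<^sup>\<star>\<close> involved.\<close>

lemma star_beta_beta:
  assumes "intertwines f"
  shows "star f t (\<beta>' (\<beta>' \<xi>)) (\<beta> (\<beta> (\<beta> u))) = - twist \<xi> (f t (\<beta> (\<beta> u)))"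
  by (simp add: star_conjugate[OF assms] transpose_map_def)

lemma star_star_star:
  assumes "intertwines f" "intertwines g" "intertwines h"
  shows "star f (\<alpha> (\<alpha> x)) (star g (\<alpha> y) (star h z \<xi>)) (\<beta> (\<beta> (\<beta> u)))
         = - twist \<xi> (h (\<alpha> (\<alpha> z)) (g (\<alpha> y) (f x u)))"
  by (simp add: assms star_conjugate inv_beta_intertwines intertwinesD)

lemma star_alpha_alpha_star_beta:
  assumes "intertwines f" "intertwines g"
  shows "star f (\<alpha> (\<alpha> x)) (star g w (\<beta>' \<xi>)) (\<beta> (\<beta> (\<beta> u)))
         = twist \<xi> (g (\<alpha> w) (f (\<alpha> x) (\<beta> u)))"
  by (simp add: assms star_conjugate inv_beta_intertwines intertwinesD transpose_map_def)

lemma star_alpha_star_alpha_beta: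
  assumes "intertwines f" "intertwines g"
  shows "star f (\<alpha> w) (star g (\<alpha> x) (\<beta>' \<xi>)) (\<beta> (\<beta> (\<beta> u)))
         = twist \<xi> (g (\<alpha> (\<alpha> x)) (f w (\<beta> u)))"
  by (simp add: assms star_conjugate inv_beta_intertwines intertwinesD transpose_map_def)

lemmas star_transpose =
  star_beta_beta star_star_star star_alpha_alpha_star_beta star_alpha_star_alpha_beta

section \<open>Linear functionals and endomorphisms of the dual\<close>

lemma vector_space_mult: "vector_space ((*) :: 'k \<Rightarrow> 'k \<Rightarrow> 'k)"
  by unfold_locales (simp_all add: algebra_simps)

lemma dual_space_linear:
  assumes "\<xi> \<in> dual_space scaleV"
  shows dual_add: "\<xi> (u + v) = \<xi> u + \<xi> v"
    and dual_diff: "\<xi> (u - v) = \<xi> u - \<xi> v"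
    and dual_minus: "\<xi> (- u) = - \<xi> u"
    and dual_scaleV: "\<xi> (scaleV c u) = c * \<xi> u"
    and dual_zero: "\<xi> 0 = 0"
proof -
  interpret xi: Vector_Spaces.linear scaleV "(*)" \<xi>
    using assms by (simp add: dual_space_def)
  show "\<xi> (u + v) = \<xi> u + \<xi> v" "\<xi> (u - v) = \<xi> u - \<xi> v" "\<xi> (- u) = - \<xi> u"
    "\<xi> (scaleV c u) = c * \<xi> u" "\<xi> 0 = 0"
    by (simp_all add: xi.add xi.diff xi.neg xi.scale)
qed

lemma endomorphism_on_dual_space:
  assumes "\<And>\<xi>. \<xi> \<in> dual_space scaleV \<Longrightarrow> T \<xi> = (\<lambda>v. s * \<xi> (g v))"
    and "Vector_Spaces.linear scaleV scaleV g"
  shows "endomorphism_on dual_scale (dual_space scaleV) T"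
proof -
  interpret g: Vector_Spaces.linear scaleV scaleV g by (rule assms(2))
  interpret D: vector_space dual_scale by (rule vector_space_dual_scale)
  have sub: "D.subspace (dual_space scaleV)"
    by (rule subspace_dual_space[OF V.vector_space_axioms])
  have val: "T \<xi> v = s * \<xi> (g v)" if "\<xi> \<in> dual_space scaleV" for \<xi> v
    using assms(1)[OF that] by simp
  have "T \<xi> \<in> dual_space scaleV" if "\<xi> \<in> dual_space scaleV" for \<xi>
    using that
    by (simp add: assms(1) dual_space_def Vector_Spaces.linear_iff
        V.vector_space_axioms vector_space_mult g.add g.scale algebra_simps)
  moreover have "T (\<xi> + \<eta>) = T \<xi> + T \<eta>"
    if "\<xi> \<in> dual_space scaleV" "\<eta> \<in> dual_space scaleV" for \<xi> \<eta>
    using that by (simp add: fun_eq_iff val D.subspace_add[OF sub] algebra_simps)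
  moreover have "T (dual_scale c \<xi>) = dual_scale c (T \<xi>)"
    if "\<xi> \<in> dual_space scaleV" for c \<xi>
    using that val[OF D.subspace_scale[OF sub that]]
    by (simp add: fun_eq_iff val dual_scale_def algebra_simps)
  ultimately show ?thesis
    by (simp add: endomorphism_on_def)
qed

text \<open>Since \<open>\<beta>\<close> is surjective, functionals can be compared on \<open>\<beta>\<^sup>3 u\<close>, the points at which
  the transposition rules are stated.\<close>

lemma dual_ext:
  assumes "\<And>u. \<phi> (\<beta> (\<beta> (\<beta> u))) = \<psi> (\<beta> (\<beta> (\<beta> u)))"
  shows "\<phi> = (\<psi> :: 'v \<Rightarrow> 'k)"
proof
  fix v show "\<phi> v = \<psi> v"
    using assms[of "inv \<beta> (inv \<beta> (inv \<beta> v))"] by simp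
qed

lemma beta_dual_closed: "\<xi> \<in> dual_space scaleV \<Longrightarrow> \<beta>' \<xi> \<in> dual_space scaleV"
  and beta_dual_endo: "endomorphism_on dual_scale (dual_space scaleV) \<beta>'"
proof -
  show e: "endomorphism_on dual_scale (dual_space scaleV) \<beta>'"
    by (rule endomorphism_on_dual_space[where s = 1 and g = "inv \<beta>"])
      (simp_all add: transpose_map_def inv_beta.linear_axioms)
  show "\<xi> \<in> dual_space scaleV \<Longrightarrow> \<beta>' \<xi> \<in> dual_space scaleV"
    using e by (simp add: endomorphism_on_def)
qed

lemma linear_rho: "Vector_Spaces.linear scaleV scaleV (\<rho> x)"
  by unfold_locales (simp_all add: l.add r.add l.scale r.scale V.scale_right_diff_distrib)

lemma star_dual_endo:
  assumes "intertwines f" "Vector_Spaces.linear scaleV scaleV (f x)"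
  shows "endomorphism_on dual_scale (dual_space scaleV) (star f x)"
proof (rule endomorphism_on_dual_space[where s = "-1" and g = "\<lambda>v. inv \<beta> (f x (inv \<beta> v))"])
  show "star f x \<xi> = (\<lambda>v. - 1 * \<xi> (inv \<beta> (f x (inv \<beta> v))))" for \<xi>
    by (rule ext) (simp add: star_conjugate[OF assms(1)])
  interpret f: Vector_Spaces.linear scaleV scaleV "f x" by (rule assms(2))
  show "Vector_Spaces.linear scaleV scaleV (\<lambda>v. inv \<beta> (f x (inv \<beta> v)))"
    by unfold_locales (simp_all add: inv_beta.add f.add inv_beta.scale f.scale)
qed

lemma star_l_endo: "endomorphism_on dual_scale (dual_space scaleV) (star l x)"
  and star_r_endo: "endomorphism_on dual_scale (dual_space scaleV) (star r x)"
  and star_rho_endo: "endomorphism_on dual_scale (dual_space scaleV) (star \<rho> x)"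
  by (rule star_dual_endo; rule intertwines_l intertwines_r intertwines_rho
      l.linear_axioms r.linear_axioms linear_rho)+

lemma star_closed:
  assumes "\<xi> \<in> dual_space scaleV"
  shows "star l x \<xi> \<in> dual_space scaleV" "star r x \<xi> \<in> dual_space scaleV"
    "star \<rho> x \<xi> \<in> dual_space scaleV"
  using assms star_l_endo star_r_endo star_rho_endo by (simp_all add: endomorphism_on_def)

lemma star_minus_arg: "star f x (- \<xi>) = - star f x \<xi>"
  by (simp add: fun_eq_iff star_action_def dual_action_def transpose_map_def)

lemma star_commutes:
  assumes "intertwines f"
  shows "star f (\<alpha> x) (\<beta>' \<xi>) = \<beta>' (star f x \<xi>)"
  by (simp add: fun_eq_iff star_conjugate[OF assms] inv_beta_intertwines[OF assms]
      transpose_map_def)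

text \<open>Linearity of \<open>\<xi>\<close> is essential here: on arbitrary functions \<open>f \<mapsto> f\<^sup>\<star>\<close> is not additive, which
  is why closure of the dual space under all operators has to be tracked in nested
  expressions.\<close>

lemma star_diff:
  assumes "\<xi> \<in> dual_space scaleV"
  shows "(star l - star r) x \<xi> = star \<rho> x \<xi>"
  by (simp add: fun_eq_iff star_conjugate intertwines_l intertwines_r intertwines_rho
      inv_beta.diff dual_diff[OF assms])

section \<open>The dual representation\<close>

lemma dual_representation:
  "hom_pre_malcev_representation scale mul \<alpha> dual_scale (dual_space scaleV)
     (star l - star r) (- star r) \<beta>'"
proof -
  interpret D: vector_space dual_scale by (rule vector_space_dual_scale)
  note inter [simp] = intertwines_l intertwines_r intertwines_rho
  let ?L = "star l - star r" and ?R = "- star r"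
  have LR: "?L - ?R = star l"
    by (simp add: fun_eq_iff)
  have R: "?R x \<xi> = - star r x \<xi>" for x \<xi>
    by simp
  note subspace_dual = subspace_dual_space[OF V.vector_space_axioms]
  note closed = star_closed beta_dual_closed D.subspace_neg[OF subspace_dual]
  note to_star = LR star_diff R star_minus_arg closed
  show ?thesis
  proof unfold_locales
    show "D.subspace (dual_space scaleV)"
      by (rule subspace_dual)
    show "endomorphism_on dual_scale (dual_space scaleV) \<beta>'"
      by (rule beta_dual_endo)
    show "endomorphism_on dual_scale (dual_space scaleV) (?L x)" for x
      using star_rho_endo[of x]
      by (simp add: endomorphism_on_def star_diff D.subspace_add D.subspace_scale subspace_dual
          del: minus_apply)
    show "endomorphism_on dual_scale (dual_space scaleV) (?R x)" for x
      using star_r_endo[of x] D.subspace_neg[OF subspace_dual]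
      by (simp add: endomorphism_on_def D.scale_minus_right)
  next
    fix \<xi> x y z c assume xi: "\<xi> \<in> dual_space scaleV"
    note twist_linear = dual_add[OF xi] dual_diff[OF xi] dual_minus[OF xi]
      dual_zero[OF xi] inv_beta.add inv_beta.diff inv_beta.neg inv_beta.zero
    show "?L (x + y) \<xi> = ?L x \<xi> + ?L y \<xi>" "?R (x + y) \<xi> = ?R x \<xi> + ?R y \<xi>"
      by (simp_all add: fun_eq_iff star_conjugate l_add r_add twist_linear)
    show "?L (scale c x) \<xi> = dual_scale c (?L x \<xi>)" "?R (scale c x) \<xi> = dual_scale c (?R x \<xi>)"
      by (simp_all add: fun_eq_iff star_conjugate l_scale r_scale dual_scaleV[OF xi]
          inv_beta.scale dual_scale_def algebra_simps)
    show "?L (\<alpha> x) (\<beta>' \<xi>) = \<beta>' (?L x \<xi>)"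
      using xi by (simp add: to_star star_commutes del: minus_apply)
    show "?R (\<alpha> x) (\<beta>' \<xi>) = \<beta>' (?R x \<xi>)"
      by (simp add: star_commutes) (simp add: fun_eq_iff transpose_map_def)
    \<comment> \<open>In each of the four identities the operators are first written through \<open>\<ell>\<^sup>\<star>\<close>, \<open>r\<^sup>\<star>\<close>, \<open>\<rho>\<^sup>\<star>\<close>
       with \<open>L - R\<close> and \<open>\<rho>\<close> kept folded, since the transposition rules apply to single
       operators; only then are the differences expanded.\<close>
    show "?L \<lbrakk>\<lbrakk>x, y\<rbrakk>, \<alpha> z\<rbrakk> (\<beta>' (\<beta>' \<xi>))
      = ?L (\<alpha> (\<alpha> x)) (?L (\<alpha> y) (?L z \<xi>))
      - ?L (\<alpha> (\<alpha> z)) (?L (\<alpha> x) (?L y \<xi>))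
      + ?L (\<alpha> (\<alpha> y)) (?L \<lbrakk>z, x\<rbrakk> (\<beta>' \<xi>))
      - ?L (\<alpha> \<lbrakk>y, z\<rbrakk>) (?L (\<alpha> x) (\<beta>' \<xi>))"
      (is "?lhs = ?rhs")
    proof (rule dual_ext)
      fix u
      show "?lhs (\<beta> (\<beta> (\<beta> u))) = ?rhs (\<beta> (\<beta> (\<beta> u)))"
        using arg_cong[OF rho_malcev_identity_reversed[where x = x and y = y and z = z and v = u],
            of "twist \<xi>"]
        by (simp add: to_star xi del: minus_apply uminus_apply)
           (simp add: star_transpose twist_linear algebra_simps)
    qed
    show "?R (\<alpha> (\<alpha> x)) ((?L - ?R) (\<alpha> y) ((?L - ?R) z \<xi>))
      - ?R (\<alpha> z \<cdot> (y \<cdot> x)) (\<beta>' (\<beta>' \<xi>))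
      + ?L (\<alpha> (\<alpha> y)) (?R (z \<cdot> x) (\<beta>' \<xi>))
      + ?L (\<alpha> \<lbrakk>z, y\<rbrakk>) (?R (\<alpha> x) (\<beta>' \<xi>))
      - ?L (\<alpha> (\<alpha> z)) (?R (\<alpha> x) ((?L - ?R) y \<xi>)) = 0"
      (is "?lhs = 0")
    proof (rule dual_ext)
      fix u
      show "?lhs (\<beta> (\<beta> (\<beta> u))) = 0 (\<beta> (\<beta> (\<beta> u)))"
        using arg_cong[OF rep4[where x = x and y = z and z = y and v = u], of "twist \<xi>"]
        by (simp add: to_star xi del: minus_apply uminus_apply)
           (simp add: star_transpose twist_linear algebra_simps)
    qed
    have bracket_swap: "r (\<lbrakk>z, y\<rbrakk> \<cdot> \<alpha> x) v = - r (\<lbrakk>y, z\<rbrakk> \<cdot> \<alpha> x) v" for v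
      by (simp add: commutator_def structure_maps_additive)
    show "?L (\<alpha> (\<alpha> y)) (?L (\<alpha> z) (?R x \<xi>))
      - ?R (\<alpha> (\<alpha> x)) ((?L - ?R) (\<alpha> y) ((?L - ?R) z \<xi>))
      - ?L (\<alpha> (\<alpha> z)) (?R (y \<cdot> x) (\<beta>' \<xi>))
      - ?R (\<alpha> (z \<cdot> x)) ((?L - ?R) (\<alpha> y) (\<beta>' \<xi>))
      + ?R (\<lbrakk>z, y\<rbrakk> \<cdot> \<alpha> x) (\<beta>' (\<beta>' \<xi>)) = 0"
      (is "?lhs = 0")
    proof (rule dual_ext)
      fix u
      show "?lhs (\<beta> (\<beta> (\<beta> u))) = 0 (\<beta> (\<beta> (\<beta> u)))"
        using arg_cong[OF rep3[where x = x and y = z and z = y and v = u], of "twist \<xi>"]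
          bracket_swap
        by (simp add: to_star xi del: minus_apply uminus_apply)
           (simp add: star_transpose twist_linear algebra_simps)
    qed
    show "?R (\<alpha> y \<cdot> (z \<cdot> x)) (\<beta>' (\<beta>' \<xi>))
      + ?R (\<alpha> (\<alpha> x)) ((?L - ?R) \<lbrakk>y, z\<rbrakk> (\<beta>' \<xi>))
      - ?L (\<alpha> (\<alpha> y)) (?L (\<alpha> z) (?R x \<xi>))
      + ?R (\<alpha> (y \<cdot> x)) ((?L - ?R) (\<alpha> z) (\<beta>' \<xi>))
      + ?L (\<alpha> (\<alpha> z)) (?R (\<alpha> x) ((?L - ?R) y \<xi>)) = 0"
      (is "?lhs = 0")
    proof (rule dual_ext)
      fix u
      show "?lhs (\<beta> (\<beta> (\<beta> u))) = 0 (\<beta> (\<beta> (\<beta> u)))"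
        using arg_cong[OF rep2[where x = x and y = z and z = y and v = u], of "twist \<xi>"]
        by (simp add: to_star xi del: minus_apply uminus_apply)
           (simp add: star_transpose twist_linear algebra_simps)
    qed
  qed
qed

end

theorem theorem3p1:
  fixes scale :: "'k::field_char_0 \<Rightarrow> 'a::ab_group_add \<Rightarrow> 'a"
    and mul :: "'a \<Rightarrow> 'a \<Rightarrow> 'a"
    and \<alpha> :: "'a \<Rightarrow> 'a"
    and scaleV :: "'k \<Rightarrow> 'v::ab_group_add \<Rightarrow> 'v"
    and l r :: "'a \<Rightarrow> 'v \<Rightarrow> 'v"
    and \<beta> :: "'v \<Rightarrow> 'v"
  assumes "hom_pre_malcev scale mul \<alpha>"
    and "hom_pre_malcev_representation scale mul \<alpha> scaleV UNIV l r \<beta>"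
    and "bij \<beta>"
  shows "hom_pre_malcev_representation scale mul \<alpha> dual_scale (dual_space scaleV)
           (star_action \<alpha> \<beta> l - star_action \<alpha> \<beta> r)
           (- star_action \<alpha> \<beta> r)
           (transpose_map (inv \<beta>))"
proof -
  interpret invertible_representation scale mul \<alpha> scaleV l r \<beta>
    using assms(2,3)
    by (intro invertible_representation.intro invertible_representation_axioms.intro)
  show ?thesis
    by (rule dual_representation)
qed

end
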